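(* There exists a set-valued operator $T:\mathbb{R}^2\rightrightarrows\mathbb{R}^2$ such that $\operatorname{gph}T$ is path-connected, $T$ is locally monotone around any point of its graph, but $T$ is not globally monotone on $\mathbb{R}^2$.
   Context: A set-valued operator $T:\mathbb{R}^2\rightrightarrows\mathbb{R}^2$ assigns to each $x\in\mathbb{R}^2$ a (possibly empty) subset $T(x)\subset\mathbb{R}^2$; its graph is $\operatorname{gph}T:=\{(x,x^* )\in\mathbb{R}^2\times\mathbb{R}^2 : x^*\in T(x)\}$, regarded as a subset of $\mathbb{R}^4$. Operators are assumed proper, i.e., with nonempty graph. $\langle\cdot,\cdot\rangle$ is the usual inner product on $\mathbb{R}^2$. A subset $S$ of a topological space is path-connected if for any two points $x\ne y$ of $S$ there is a continuous map $\varphi:[0,1]\to S$ with $\varphi(0)=x$ and $\varphi(1)=y$. $T$ is (globally) monotone on $\mathbb{R}^2$ if $\langle x^*-y^*,x-y\rangle\ge 0$ for all $(x,x^* ),(y,y^* )\in\operatorname{gph}T$. $T$ is locally monotone around $(u,u^* )\in\operatorname{gph}T$ if there exists a neighborhood $W\subset\mathbb{R}^2\times\mathbb{R}^2$ of $(u,u^* )$ such that $\langle x^*-y^*,x-y\rangle\ge 0$ for all $(x,x^* ),(y,y^* )\in\operatorname{gph}T\cap W$. *)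

theory Defs
  imports "HOL-Analysis.Analysis"
begin

type_synonym 'a set_operator = "'a \<Rightarrow> 'a set"

definition gph :: "'a set_operator \<Rightarrow> ('a \<times> 'a) set" where
  "gph T = {(x, x'). x' \<in> T x}"

definition proper_operator :: "'a set_operator \<Rightarrow> bool" where
  "proper_operator T \<longleftrightarrow> gph T \<noteq> {}"

definition monotone_operator :: "('a::real_inner) set_operator \<Rightarrow> bool" where
  "monotone_operator T \<longleftrightarrow>
     (\<forall>(x, x') \<in> gph T. \<forall>(y, y') \<in> gph T. (x' - y') \<bullet> (x - y) \<ge> 0)"

(* Neighborhoods are not required to be open: p \<in> interior W says that W is a neighborhood of p. *)
definition locally_monotone_around :: "('a::real_inner) set_operator \<Rightarrow> 'a \<times> 'a \<Rightarrow> bool" where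
  "locally_monotone_around T p \<longleftrightarrow>
     (\<exists>W. p \<in> interior W \<and>
       (\<forall>(x, x') \<in> gph T \<inter> W. \<forall>(y, y') \<in> gph T \<inter> W. (x' - y') \<bullet> (x - y) \<ge> 0))"

end

theory Submission
  imports Defs
begin

text \<open>Give the operator a graph in which the second coordinate of the argument is always \<open>0\<close>.
  The second coordinate \<open>z\<close> of the value then drops out of the inner product, which for the
  points with first coordinates \<open>(x, y)\<close> and \<open>(x', y')\<close> is \<open>(x - x') * (y - y')\<close>. So
  \<open>z\<close> is a free height, which can keep apart two pieces of the graph that are not monotone
  together.

  The graph consists of the half-plane \<open>x \<ge> 0, y = 0\<close> (all heights), the ray \<open>x \<le> 0, y = 0\<close>
  attached to it at height \<open>0\<close>, and the ray \<open>x = 0, y \<le> 0\<close> attached to it at height \<open>1\<close>.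
  Each ray is monotone together with the half-plane: the first keeps \<open>y\<close> constant, and the second
  continues the line \<open>y = 0, x \<ge> 0\<close> downwards at its left end. The open sets \<open>z < 1\<close> and
  \<open>z > 0\<close> cover the space and each of them misses one ray, which gives local monotonicity.
  The two rays are not monotone together: their points \<open>(-1, 0)\<close> and \<open>(0, -1)\<close> give \<open>-1\<close>.\<close>

definition spiral_operator :: "(real ^ 2) set_operator" where
  "spiral_operator x = {x'. x $ 2 = 0 \<and>
     (x $ 1 \<ge> 0 \<and> x' $ 1 = 0 \<or>
      x $ 1 \<le> 0 \<and> x' $ 1 = 0 \<and> x' $ 2 = 0 \<or>
      x $ 1 = 0 \<and> x' $ 1 \<le> 0 \<and> x' $ 2 = 1)}"

lemma inner_real_2: "(u :: real ^ 2) \<bullet> v = u $ 1 * v $ 1 + u $ 2 * v $ 2"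
  by (simp add: inner_vec_def sum_2)

lemma path_connected_gph_spiral_operator: "path_connected (gph spiral_operator)"
proof -
  define H :: "((real ^ 2) \<times> (real ^ 2)) set" where
    "H = {(x, x'). x $ 2 = 0 \<and> x $ 1 \<ge> 0 \<and> x' $ 1 = 0}"
  define R0 :: "((real ^ 2) \<times> (real ^ 2)) set" where
    "R0 = {(x, x'). x $ 2 = 0 \<and> x $ 1 \<le> 0 \<and> x' $ 1 = 0 \<and> x' $ 2 = 0}"
  define R1 :: "((real ^ 2) \<times> (real ^ 2)) set" where
    "R1 = {(x, x'). x $ 2 = 0 \<and> x $ 1 = 0 \<and> x' $ 1 \<le> 0 \<and> x' $ 2 = 1}"
  have "convex H"
    by (auto simp: H_def convex_def)
  moreover have "convex R0"
    by (auto simp: R0_def convex_def mult_nonneg_nonpos add_nonpos_nonpos)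
  moreover have "convex R1"
    by (auto simp: R1_def convex_def mult_nonneg_nonpos add_nonpos_nonpos)
  moreover have "(0, 0) \<in> H \<inter> R0"
    by (simp add: H_def R0_def)
  moreover have "(0, axis 2 1) \<in> (H \<union> R0) \<inter> R1"
    by (simp add: H_def R1_def axis_def)
  ultimately have "path_connected ((H \<union> R0) \<union> R1)"
    by (intro path_connected_Un convex_imp_path_connected) blast+
  moreover have "gph spiral_operator = (H \<union> R0) \<union> R1"
    by (auto simp: gph_def spiral_operator_def H_def R0_def R1_def)
  ultimately show ?thesis
    by simp
qed

lemma locally_monotone_around_spiral_operator: "locally_monotone_around spiral_operator p"
proof (cases "snd p $ 2 < 1")
  case True
  define W :: "((real ^ 2) \<times> (real ^ 2)) set" where "W = {q. snd q $ 2 < 1}"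
  have "open W"
    unfolding W_def by (intro open_Collect_less continuous_intros)
  then have "p \<in> interior W"
    using True by (simp add: interior_open W_def)
  moreover have "\<forall>(x, x') \<in> gph spiral_operator \<inter> W. \<forall>(y, y') \<in> gph spiral_operator \<inter> W.
      (x' - y') \<bullet> (x - y) \<ge> 0"
    by (auto simp: gph_def spiral_operator_def W_def inner_real_2)
  ultimately show ?thesis
    unfolding locally_monotone_around_def by blast
next
  case False
  define W :: "((real ^ 2) \<times> (real ^ 2)) set" where "W = {q. 0 < snd q $ 2}"
  have "open W"
    unfolding W_def by (intro open_Collect_less continuous_intros)
  then have "p \<in> interior W"
    using False by (simp add: interior_open W_def)
  moreover have "\<forall>(x, x') \<in> gph spiral_operator \<inter> W. \<forall>(y, y') \<in> gph spiral_operator \<inter> W.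
      (x' - y') \<bullet> (x - y) \<ge> 0"
    by (auto simp: gph_def spiral_operator_def W_def inner_real_2 mult_nonpos_nonneg
        mult_nonpos_nonpos)
  ultimately show ?thesis
    unfolding locally_monotone_around_def by blast
qed

lemma not_monotone_spiral_operator: "\<not> monotone_operator spiral_operator"
proof
  define x y y' :: "real ^ 2" where "x = axis 1 (- 1)" and "y = 0" and "y' = vector [- 1, 1]"
  assume "monotone_operator spiral_operator"
  moreover have "(x, 0) \<in> gph spiral_operator" "(y, y') \<in> gph spiral_operator"
    by (simp_all add: gph_def spiral_operator_def x_def y_def y'_def axis_def)
  ultimately have "(0 - y') \<bullet> (x - y) \<ge> 0"
    unfolding monotone_operator_def by blast
  then show False
    by (simp add: x_def y_def y'_def inner_real_2 axis_def)
qed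

theorem mainTheorem3:
  shows "\<exists>T :: (real ^ 2) set_operator.
           proper_operator T \<and>
           path_connected (gph T) \<and>
           (\<forall>p \<in> gph T. locally_monotone_around T p) \<and>
           \<not> monotone_operator T"
proof -
  have "(0, 0) \<in> gph spiral_operator"
    by (simp add: gph_def spiral_operator_def)
  then have "proper_operator spiral_operator"
    unfolding proper_operator_def by blast
  then show ?thesis
    using path_connected_gph_spiral_operator locally_monotone_around_spiral_operator
      not_monotone_spiral_operator by blast
qed

end
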